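(* Let $(\mathcal{A},\mathcal{E})$ be an exact category and let $f: X\to Y$ be a non-zero admissible morphism in $(\mathcal{A},\mathcal{E})$, that is, a non-zero morphism that can be factored as an admissible epic followed by an admissible monic. Then the following hold: (1) if $X$ is $\mathcal{E}$-simple, then $f$ is an admissible monic; (2) if $Y$ is $\mathcal{E}$-simple, then $f$ is an admissible epic.
   Context: An exact category $(\mathcal{A},\mathcal{E})$ is an additive category $\mathcal{A}$ with a Quillen exact structure $\mathcal{E}$: a class, closed under isomorphisms, of kernel-cokernel pairs $(i,d)$ ($i$ is a kernel of $d$ and $d$ is a cokernel of $i$). If $(i,d)\in\mathcal{E}$, then $i$ is called an admissible monic and $d$ an admissible epic. It is required that identities are admissible monics and admissible epics; that admissible monics are closed under composition, and likewise admissible epics; that push-outs of admissible monics along arbitrary morphisms exist and yield admissible monics; and that pull-backs of admissible epics along arbitrary morphisms exist and yield admissible epics. A morphism $f$ is admissible if $f=m\circ e$ with $e$ an admissible epic and $m$ an admissible monic. An $\mathcal{E}$-subobject of $B$ is a pair $(A,i)$ with $i:A\to B$ an admissible monic; one writes $A\subset_{\mathcal{E}}B$. A non-zero object $S$ is $\mathcal{E}$-simple if it admits no $\mathcal{E}$-subobjects except $0$ and $S$, that is, whenever $A\subset_{\mathcal{E}}S$, then $A$ is the zero object or isomorphic to $S$, where "the subobject is $S$" is understood as: the admissible monic $A\to S$ is an isomorphism. *)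

theory Defs
  imports "HOL-Algebra.Group"
begin

text \<open>
  Every arrow has a unique domain and codomain. \<open>Comp\<close> and \<open>Plus\<close> are total functions that are only
  meaningful on composable and on parallel arrows, respectively.
\<close>

record ('o, 'm) category_data =
  Ob :: "'o set"
  Ar :: "'m set"
  Dom :: "'m \<Rightarrow> 'o"
  Cod :: "'m \<Rightarrow> 'o"
  Ident :: "'o \<Rightarrow> 'm"
  Comp :: "'m \<Rightarrow> 'm \<Rightarrow> 'm" (infixr "\<cdot>\<index>" 70)

record ('o, 'm) preadditive_data = "('o, 'm) category_data" +
  Plus :: "'m \<Rightarrow> 'm \<Rightarrow> 'm" (infixl "\<oplus>\<index>" 65)
  Zero :: "'o \<Rightarrow> 'o \<Rightarrow> 'm"

definition Hom :: "('o, 'm, 'x) category_data_scheme \<Rightarrow> 'o \<Rightarrow> 'o \<Rightarrow> 'm set" where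
  "Hom C A B = {f \<in> Ar C. Dom C f = A \<and> Cod C f = B}"

definition Hom_group :: "('o, 'm, 'x) preadditive_data_scheme \<Rightarrow> 'o \<Rightarrow> 'o \<Rightarrow> 'm monoid" where
  "Hom_group C A B = \<lparr>carrier = Hom C A B, mult = Plus C, one = Zero C A B\<rparr>"

locale category =
  fixes C :: "('o, 'm, 'x) category_data_scheme" (structure)
  assumes Dom_in_Ob: "f \<in> Ar C \<Longrightarrow> Dom C f \<in> Ob C"
    and Cod_in_Ob: "f \<in> Ar C \<Longrightarrow> Cod C f \<in> Ob C"
    and Ident_in_Hom: "A \<in> Ob C \<Longrightarrow> Ident C A \<in> Hom C A A"
    and Comp_in_Hom: "\<lbrakk>f \<in> Hom C A B; g \<in> Hom C B D\<rbrakk> \<Longrightarrow> g \<cdot> f \<in> Hom C A D"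
    and Comp_Ident_right: "f \<in> Hom C A B \<Longrightarrow> f \<cdot> Ident C A = f"
    and Comp_Ident_left: "f \<in> Hom C A B \<Longrightarrow> Ident C B \<cdot> f = f"
    and Comp_assoc: "\<lbrakk>f \<in> Hom C A B; g \<in> Hom C B D; h \<in> Hom C D F\<rbrakk> \<Longrightarrow> (h \<cdot> g) \<cdot> f = h \<cdot> (g \<cdot> f)"

definition is_iso :: "('o, 'm, 'x) category_data_scheme \<Rightarrow> 'm \<Rightarrow> bool" where
  "is_iso C f \<longleftrightarrow> f \<in> Ar C \<and>
     (\<exists>g \<in> Hom C (Cod C f) (Dom C f). g \<cdot>\<^bsub>C\<^esub> f = Ident C (Dom C f) \<and> f \<cdot>\<^bsub>C\<^esub> g = Ident C (Cod C f))"

definition is_zero_object :: "('o, 'm, 'x) category_data_scheme \<Rightarrow> 'o \<Rightarrow> bool" where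
  "is_zero_object C Z \<longleftrightarrow> Z \<in> Ob C \<and>
     (\<forall>A \<in> Ob C. (\<exists>!f. f \<in> Hom C Z A) \<and> (\<exists>!f. f \<in> Hom C A Z))"

definition is_biproduct ::
    "('o, 'm, 'x) preadditive_data_scheme \<Rightarrow> 'o \<Rightarrow> 'o \<Rightarrow> 'o \<Rightarrow> 'm \<Rightarrow> 'm \<Rightarrow> 'm \<Rightarrow> 'm \<Rightarrow> bool" where
  "is_biproduct C A B P \<iota>\<^sub>A \<iota>\<^sub>B \<pi>\<^sub>A \<pi>\<^sub>B \<longleftrightarrow>
     \<iota>\<^sub>A \<in> Hom C A P \<and> \<iota>\<^sub>B \<in> Hom C B P \<and> \<pi>\<^sub>A \<in> Hom C P A \<and> \<pi>\<^sub>B \<in> Hom C P B \<and>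
     \<pi>\<^sub>A \<cdot>\<^bsub>C\<^esub> \<iota>\<^sub>A = Ident C A \<and> \<pi>\<^sub>B \<cdot>\<^bsub>C\<^esub> \<iota>\<^sub>B = Ident C B \<and>
     \<pi>\<^sub>A \<cdot>\<^bsub>C\<^esub> \<iota>\<^sub>B = Zero C B A \<and> \<pi>\<^sub>B \<cdot>\<^bsub>C\<^esub> \<iota>\<^sub>A = Zero C A B \<and>
     (\<iota>\<^sub>A \<cdot>\<^bsub>C\<^esub> \<pi>\<^sub>A) \<oplus>\<^bsub>C\<^esub> (\<iota>\<^sub>B \<cdot>\<^bsub>C\<^esub> \<pi>\<^sub>B) = Ident C P"

locale preadditive_category = category C
  for C :: "('o, 'm, 'x) preadditive_data_scheme" (structure) +
  assumes Hom_comm_group: "\<lbrakk>A \<in> Ob C; B \<in> Ob C\<rbrakk> \<Longrightarrow> comm_group (Hom_group C A B)"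
    and Comp_Plus_left: "\<lbrakk>f \<in> Hom C A B; g \<in> Hom C B D; h \<in> Hom C B D\<rbrakk>
      \<Longrightarrow> (g \<oplus> h) \<cdot> f = (g \<cdot> f) \<oplus> (h \<cdot> f)"
    and Comp_Plus_right: "\<lbrakk>f \<in> Hom C A B; g \<in> Hom C A B; h \<in> Hom C B D\<rbrakk>
      \<Longrightarrow> h \<cdot> (f \<oplus> g) = (h \<cdot> f) \<oplus> (h \<cdot> g)"

locale additive_category = preadditive_category +
  assumes ex_zero_object: "\<exists>Z. is_zero_object C Z"
    and ex_biproduct: "\<lbrakk>A \<in> Ob C; B \<in> Ob C\<rbrakk> \<Longrightarrow> \<exists>P \<iota>\<^sub>A \<iota>\<^sub>B \<pi>\<^sub>A \<pi>\<^sub>B. is_biproduct C A B P \<iota>\<^sub>A \<iota>\<^sub>B \<pi>\<^sub>A \<pi>\<^sub>B"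

definition is_kernel :: "('o, 'm, 'x) preadditive_data_scheme \<Rightarrow> 'm \<Rightarrow> 'm \<Rightarrow> bool" where
  "is_kernel C i d \<longleftrightarrow> i \<in> Ar C \<and> d \<in> Ar C \<and> Cod C i = Dom C d \<and>
     d \<cdot>\<^bsub>C\<^esub> i = Zero C (Dom C i) (Cod C d) \<and>
     (\<forall>T \<in> Ob C. \<forall>t \<in> Hom C T (Dom C d). d \<cdot>\<^bsub>C\<^esub> t = Zero C T (Cod C d) \<longrightarrow>
        (\<exists>!u. u \<in> Hom C T (Dom C i) \<and> i \<cdot>\<^bsub>C\<^esub> u = t))"

definition is_cokernel :: "('o, 'm, 'x) preadditive_data_scheme \<Rightarrow> 'm \<Rightarrow> 'm \<Rightarrow> bool" where
  "is_cokernel C d i \<longleftrightarrow> i \<in> Ar C \<and> d \<in> Ar C \<and> Cod C i = Dom C d \<and>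
     d \<cdot>\<^bsub>C\<^esub> i = Zero C (Dom C i) (Cod C d) \<and>
     (\<forall>T \<in> Ob C. \<forall>t \<in> Hom C (Cod C i) T. t \<cdot>\<^bsub>C\<^esub> i = Zero C (Dom C i) T \<longrightarrow>
        (\<exists>!u. u \<in> Hom C (Cod C d) T \<and> u \<cdot>\<^bsub>C\<^esub> d = t))"

definition kernel_cokernel_pair :: "('o, 'm, 'x) preadditive_data_scheme \<Rightarrow> 'm \<Rightarrow> 'm \<Rightarrow> bool" where
  "kernel_cokernel_pair C i d \<longleftrightarrow> is_kernel C i d \<and> is_cokernel C d i"

definition isomorphic_pairs ::
    "('o, 'm, 'x) category_data_scheme \<Rightarrow> 'm \<times> 'm \<Rightarrow> 'm \<times> 'm \<Rightarrow> bool" where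
  "isomorphic_pairs C = (\<lambda>(i, d) (i', d').
     \<exists>a b c. is_iso C a \<and> is_iso C b \<and> is_iso C c \<and>
       a \<in> Hom C (Dom C i) (Dom C i') \<and>
       b \<in> Hom C (Cod C i) (Cod C i') \<and>
       c \<in> Hom C (Cod C d) (Cod C d') \<and>
       b \<cdot>\<^bsub>C\<^esub> i = i' \<cdot>\<^bsub>C\<^esub> a \<and> c \<cdot>\<^bsub>C\<^esub> d = d' \<cdot>\<^bsub>C\<^esub> b)"

text \<open>The commutative square \<open>f' \<cdot> i = i' \<cdot> f\<close> is a push-out of the span \<open>(i, f)\<close>.\<close>

definition is_pushout :: "('o, 'm, 'x) category_data_scheme \<Rightarrow> 'm \<Rightarrow> 'm \<Rightarrow> 'm \<Rightarrow> 'm \<Rightarrow> bool" where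
  "is_pushout C i f f' i' \<longleftrightarrow> {i, f, f', i'} \<subseteq> Ar C \<and> Dom C i = Dom C f \<and>
     Dom C f' = Cod C i \<and> Dom C i' = Cod C f \<and> Cod C f' = Cod C i' \<and>
     f' \<cdot>\<^bsub>C\<^esub> i = i' \<cdot>\<^bsub>C\<^esub> f \<and>
     (\<forall>T \<in> Ob C. \<forall>s \<in> Hom C (Cod C i) T. \<forall>t \<in> Hom C (Cod C f) T. s \<cdot>\<^bsub>C\<^esub> i = t \<cdot>\<^bsub>C\<^esub> f \<longrightarrow>
        (\<exists>!u. u \<in> Hom C (Cod C i') T \<and> u \<cdot>\<^bsub>C\<^esub> f' = s \<and> u \<cdot>\<^bsub>C\<^esub> i' = t))"

text \<open>The commutative square \<open>d \<cdot> f' = f \<cdot> d'\<close> is a pull-back of the cospan \<open>(d, f)\<close>.\<close>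

definition is_pullback :: "('o, 'm, 'x) category_data_scheme \<Rightarrow> 'm \<Rightarrow> 'm \<Rightarrow> 'm \<Rightarrow> 'm \<Rightarrow> bool" where
  "is_pullback C d f f' d' \<longleftrightarrow> {d, f, f', d'} \<subseteq> Ar C \<and> Cod C d = Cod C f \<and>
     Cod C f' = Dom C d \<and> Cod C d' = Dom C f \<and> Dom C f' = Dom C d' \<and>
     d \<cdot>\<^bsub>C\<^esub> f' = f \<cdot>\<^bsub>C\<^esub> d' \<and>
     (\<forall>T \<in> Ob C. \<forall>s \<in> Hom C T (Dom C d). \<forall>t \<in> Hom C T (Dom C f). d \<cdot>\<^bsub>C\<^esub> s = f \<cdot>\<^bsub>C\<^esub> t \<longrightarrow>
        (\<exists>!u. u \<in> Hom C T (Dom C d') \<and> f' \<cdot>\<^bsub>C\<^esub> u = s \<and> d' \<cdot>\<^bsub>C\<^esub> u = t))"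

definition admissible_monic :: "('m \<times> 'm) set \<Rightarrow> 'm \<Rightarrow> bool" where
  "admissible_monic \<E> i \<longleftrightarrow> (\<exists>d. (i, d) \<in> \<E>)"

definition admissible_epic :: "('m \<times> 'm) set \<Rightarrow> 'm \<Rightarrow> bool" where
  "admissible_epic \<E> d \<longleftrightarrow> (\<exists>i. (i, d) \<in> \<E>)"

text \<open>
  Since \<open>\<E>\<close> is closed under isomorphisms, it does not matter that the last two axioms speak about
  some push-out (pull-back) rather than about every one.
\<close>

locale exact_category = additive_category C
  for C :: "('o, 'm, 'x) preadditive_data_scheme" (structure) +
  fixes \<E> :: "('m \<times> 'm) set"
  assumes kernel_cokernel: "(i, d) \<in> \<E> \<Longrightarrow> kernel_cokernel_pair C i d"
    and iso_closed: "\<lbrakk>(i, d) \<in> \<E>; kernel_cokernel_pair C i' d'; isomorphic_pairs C (i, d) (i', d')\<rbrakk>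
      \<Longrightarrow> (i', d') \<in> \<E>"
    and Ident_monic: "A \<in> Ob C \<Longrightarrow> admissible_monic \<E> (Ident C A)"
    and Ident_epic: "A \<in> Ob C \<Longrightarrow> admissible_epic \<E> (Ident C A)"
    and Comp_monic: "\<lbrakk>admissible_monic \<E> i; admissible_monic \<E> j; Cod C i = Dom C j\<rbrakk>
      \<Longrightarrow> admissible_monic \<E> (j \<cdot> i)"
    and Comp_epic: "\<lbrakk>admissible_epic \<E> d; admissible_epic \<E> e; Cod C d = Dom C e\<rbrakk>
      \<Longrightarrow> admissible_epic \<E> (e \<cdot> d)"
    and pushout_monic: "\<lbrakk>admissible_monic \<E> i; f \<in> Ar C; Dom C f = Dom C i\<rbrakk>
      \<Longrightarrow> \<exists>f' i'. is_pushout C i f f' i' \<and> admissible_monic \<E> i'"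
    and pullback_epic: "\<lbrakk>admissible_epic \<E> d; f \<in> Ar C; Cod C f = Cod C d\<rbrakk>
      \<Longrightarrow> \<exists>f' d'. is_pullback C d f f' d' \<and> admissible_epic \<E> d'"

definition admissible_morphism ::
    "('o, 'm, 'x) preadditive_data_scheme \<Rightarrow> ('m \<times> 'm) set \<Rightarrow> 'm \<Rightarrow> bool" where
  "admissible_morphism C \<E> f \<longleftrightarrow>
     (\<exists>e m. admissible_epic \<E> e \<and> admissible_monic \<E> m \<and> Cod C e = Dom C m \<and> f = m \<cdot>\<^bsub>C\<^esub> e)"

definition subobject ::
    "('o, 'm, 'x) preadditive_data_scheme \<Rightarrow> ('m \<times> 'm) set \<Rightarrow> 'o \<Rightarrow> 'o \<Rightarrow> 'm \<Rightarrow> bool" where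
  "subobject C \<E> B A i \<longleftrightarrow> i \<in> Hom C A B \<and> admissible_monic \<E> i"

definition simple_object ::
    "('o, 'm, 'x) preadditive_data_scheme \<Rightarrow> ('m \<times> 'm) set \<Rightarrow> 'o \<Rightarrow> bool" where
  "simple_object C \<E> S \<longleftrightarrow> S \<in> Ob C \<and> \<not> is_zero_object C S \<and>
     (\<forall>A i. subobject C \<E> S A i \<longrightarrow> is_zero_object C A \<or> is_iso C i)"

end

theory Submission
  imports Defs
begin

text \<open>
  Write \<open>f = m \<cdot> e\<close> with \<open>e\<close> an admissible epic and \<open>m\<close> an admissible monic. If \<open>X\<close> is simple, the
  kernel of \<open>e\<close> is either an isomorphism, which would force \<open>e = 0\<close>, or starts at a zero object, in
  which case its cokernel \<open>e\<close> is an isomorphism. If \<open>Y\<close> is simple, the subobject \<open>m\<close> either starts at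
  a zero object, which would force \<open>f = 0\<close>, or is an isomorphism. In both cases, \<open>f\<close> is obtained from
  the remaining factor, an admissible monic or epic, by composing with an isomorphism.
\<close>

section \<open>Hom-sets and isomorphisms\<close>

lemma Hom_Dom: "f \<in> Hom C A B \<Longrightarrow> Dom C f = A"
  and Hom_Cod: "f \<in> Hom C A B \<Longrightarrow> Cod C f = B"
  and Hom_Ar: "f \<in> Hom C A B \<Longrightarrow> f \<in> Ar C"
  by (simp_all add: Hom_def)

context category
begin

lemma Hom_Ob:
  assumes "f \<in> Hom C A B"
  shows "A \<in> Ob C" and "B \<in> Ob C"
  using assms Dom_in_Ob Cod_in_Ob by (auto simp: Hom_def)

lemma is_isoI:
  assumes "f \<in> Hom C A B" and "g \<in> Hom C B A" and "g \<cdot> f = Ident C A" and "f \<cdot> g = Ident C B"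
  shows "is_iso C f"
  using assms unfolding is_iso_def by (auto simp: Hom_def)

lemma is_isoE:
  assumes "is_iso C f" and "f \<in> Hom C A B"
  obtains g where "g \<in> Hom C B A" and "g \<cdot> f = Ident C A" and "f \<cdot> g = Ident C B"
  using assms unfolding is_iso_def by (auto simp: Hom_def)

lemma is_iso_Ident: "A \<in> Ob C \<Longrightarrow> is_iso C (Ident C A)"
  using is_isoI[OF Ident_in_Hom Ident_in_Hom] Comp_Ident_left[OF Ident_in_Hom] by simp

end

section \<open>Zero morphisms, kernels and cokernels in preadditive categories\<close>

context preadditive_category
begin

lemma Zero_in_Hom:
  assumes "A \<in> Ob C" and "B \<in> Ob C"
  shows "Zero C A B \<in> Hom C A B"
proof -
  interpret G: comm_group "Hom_group C A B" using Hom_comm_group assms .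
  show ?thesis using G.one_closed by (simp add: Hom_group_def)
qed

lemma Plus_Zero_Zero:
  assumes "A \<in> Ob C" and "B \<in> Ob C"
  shows "Zero C A B \<oplus> Zero C A B = Zero C A B"
proof -
  interpret G: comm_group "Hom_group C A B" using Hom_comm_group assms .
  show ?thesis using G.l_one[OF G.one_closed] by (simp add: Hom_group_def)
qed

text \<open>Cancellation in the hom group. By biadditivity of composition, a composite with a zero
  morphism equals its own double, so this is what makes such composites vanish in the next two
  lemmas.\<close>

lemma Plus_idem_imp_Zero:
  assumes "x \<in> Hom C A B" and "x \<oplus> x = x"
  shows "x = Zero C A B"
proof -
  interpret G: comm_group "Hom_group C A B" using Hom_comm_group Hom_Ob assms by blast
  show ?thesis using G.r_cancel_one[of x x] assms by (simp add: Hom_group_def)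
qed

lemma Comp_Zero_left:
  assumes "f \<in> Hom C A B" and "D \<in> Ob C"
  shows "Zero C B D \<cdot> f = Zero C A D"
proof -
  have B: "B \<in> Ob C" using Hom_Ob assms by blast
  have Z: "Zero C B D \<in> Hom C B D" using Zero_in_Hom B assms(2) .
  show ?thesis
    using Plus_idem_imp_Zero[OF Comp_in_Hom[OF assms(1) Z]]
      Comp_Plus_left[OF assms(1) Z Z] Plus_Zero_Zero[OF B assms(2)] by simp
qed

lemma Comp_Zero_right:
  assumes "f \<in> Hom C A B" and "D \<in> Ob C"
  shows "f \<cdot> Zero C D A = Zero C D B"
proof -
  have A: "A \<in> Ob C" using Hom_Ob assms by blast
  have Z: "Zero C D A \<in> Hom C D A" using Zero_in_Hom assms(2) A .
  show ?thesis
    using Plus_idem_imp_Zero[OF Comp_in_Hom[OF Z assms(1)]]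
      Comp_Plus_right[OF Z Z assms(1)] Plus_Zero_Zero[OF assms(2) A] by simp
qed

lemma from_zero_object_eq_Zero:
  assumes "is_zero_object C A" and "f \<in> Hom C A B"
  shows "f = Zero C A B"
  using assms Zero_in_Hom[of A B] Hom_Ob[OF assms(2)] unfolding is_zero_object_def by blast

text \<open>An isomorphism cancels on the right via its inverse. Applied to a kernel
  \<open>k\<close> of \<open>e\<close>, it shows that only the zero morphism has an invertible
  kernel.\<close>

lemma Comp_iso_eq_Zero:
  assumes "k \<in> Hom C A B" and "is_iso C k" and "e \<in> Hom C B D" and "e \<cdot> k = Zero C A D"
  shows "e = Zero C B D"
proof -
  obtain g where g: "g \<in> Hom C B A" "k \<cdot> g = Ident C B"
    using is_isoE[OF assms(2,1)] by metis
  have "e = (e \<cdot> k) \<cdot> g"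
    using Comp_assoc[OF g(1) assms(1,3)] g(2) Comp_Ident_right[OF assms(3)] by simp
  also have "\<dots> = Zero C B D"
    using assms(4) Comp_Zero_left[OF g(1)] Hom_Ob[OF assms(3)] by simp
  finally show ?thesis .
qed

lemma iso_Comp_eq_Zero:
  assumes "k \<in> Hom C B D" and "is_iso C k" and "e \<in> Hom C A B" and "k \<cdot> e = Zero C A D"
  shows "e = Zero C A B"
proof -
  obtain g where g: "g \<in> Hom C D B" "g \<cdot> k = Ident C B"
    using is_isoE[OF assms(2,1)] by metis
  have "e = g \<cdot> (k \<cdot> e)"
    using Comp_assoc[OF assms(3,1) g(1)] g(2) Comp_Ident_left[OF assms(3)] by simp
  also have "\<dots> = Zero C A B"
    using assms(4) Comp_Zero_right[OF g(1)] Hom_Ob[OF assms(3)] by simp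
  finally show ?thesis .
qed

text \<open>The universal property with named endpoints in place of \<open>Dom\<close> and
  \<open>Cod\<close> terms, so that it chains with the hom-set facts;
  \<open>cokernel_factors\<close> serves the same purpose.\<close>

lemma kernel_factors:
  assumes "is_kernel C i d" and "i \<in> Hom C A B" and "d \<in> Hom C B D"
    and "t \<in> Hom C T B" and "d \<cdot> t = Zero C T D"
  shows "\<exists>!u. u \<in> Hom C T A \<and> i \<cdot> u = t"
proof -
  have "\<forall>T \<in> Ob C. \<forall>t \<in> Hom C T B. d \<cdot> t = Zero C T D \<longrightarrow> (\<exists>!u. u \<in> Hom C T A \<and> i \<cdot> u = t)"
    using assms(1) unfolding is_kernel_def
      Hom_Dom[OF assms(2)] Hom_Dom[OF assms(3)] Hom_Cod[OF assms(3)] by (elim conjE)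
  from this[rule_format, OF Hom_Ob(1)[OF assms(4)] assms(4,5)] show ?thesis .
qed

lemma cokernel_factors:
  assumes "is_cokernel C d i" and "i \<in> Hom C A B" and "d \<in> Hom C B D"
    and "t \<in> Hom C B T" and "t \<cdot> i = Zero C A T"
  shows "\<exists>!u. u \<in> Hom C D T \<and> u \<cdot> d = t"
proof -
  have "\<forall>T \<in> Ob C. \<forall>t \<in> Hom C B T. t \<cdot> i = Zero C A T \<longrightarrow> (\<exists>!u. u \<in> Hom C D T \<and> u \<cdot> d = t)"
    using assms(1) unfolding is_cokernel_def
      Hom_Dom[OF assms(2)] Hom_Cod[OF assms(2)] Hom_Cod[OF assms(3)] by (elim conjE)
  from this[rule_format, OF Hom_Ob(2)[OF assms(4)] assms(4,5)] show ?thesis .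
qed

text \<open>Here \<open>k\<close> is zero, so the identity of its codomain kills \<open>k\<close>
  and factors through \<open>e\<close>. This yields a left inverse of \<open>e\<close>, and
  uniqueness of factorizations through \<open>e\<close> makes it two-sided.\<close>

lemma cokernel_of_zero_object_iso:
  assumes "is_cokernel C e k" and "is_zero_object C (Dom C k)"
  shows "is_iso C e"
proof -
  define K X I where "K = Dom C k" and "X = Cod C k" and "I = Cod C e"
  have k: "k \<in> Hom C K X" and e: "e \<in> Hom C X I" and ek: "e \<cdot> k = Zero C K I"
    using assms(1) by (auto simp: is_cokernel_def Hom_def K_def X_def I_def)
  note univ = cokernel_factors[OF assms(1) k e]
  have X: "X \<in> Ob C" and I: "I \<in> Ob C" using Hom_Ob[OF e] by auto
  have "k = Zero C K X" using assms(2) k unfolding K_def by (rule from_zero_object_eq_Zero)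
  with Comp_Ident_left[OF k] have "Ident C X \<cdot> k = Zero C K X" by (rule trans)
  then obtain u where u: "u \<in> Hom C I X" "u \<cdot> e = Ident C X"
    using univ[OF Ident_in_Hom[OF X]] by blast
  have "(e \<cdot> u) \<cdot> e = e"
    using Comp_assoc[OF e u(1) e] u(2) Comp_Ident_right[OF e] by simp
  \<comment> \<open>The test morphism is now \<open>e\<close> itself: \<open>e \<cdot> u\<close> and
    the identity both factor it through \<open>e\<close>.\<close>
  then have "e \<cdot> u = Ident C I"
    using univ[OF e ek] Comp_in_Hom[OF u(1) e] Ident_in_Hom[OF I] Comp_Ident_left[OF e] by blast
  with e u show ?thesis by (blast intro: is_isoI)
qed

text \<open>A morphism kills \<open>m \<cdot> e\<close> iff it kills \<open>m\<close>, and
  factorizations through \<open>m\<close> transfer along the inverse of \<open>e\<close>. The result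
  is needed because \<open>iso_closed\<close> takes the kernel-cokernel property of the new pair as
  a premise.\<close>

lemma kernel_cokernel_pair_Comp_iso_right:
  assumes "kernel_cokernel_pair C m d" and "is_iso C e" and "Cod C e = Dom C m"
  shows "kernel_cokernel_pair C (m \<cdot> e) d"
proof -
  define X I Y W where "X = Dom C e" and "I = Dom C m" and "Y = Cod C m" and "W = Cod C d"
  have m: "m \<in> Hom C I Y" and d: "d \<in> Hom C Y W" and dm: "d \<cdot> m = Zero C I W"
    using assms(1)
    by (auto simp: kernel_cokernel_pair_def is_kernel_def Hom_def I_def Y_def W_def)
  have e: "e \<in> Hom C X I"
    using assms(2,3) by (simp add: is_iso_def Hom_def X_def I_def)
  obtain g where g: "g \<in> Hom C I X" "g \<cdot> e = Ident C X" "e \<cdot> g = Ident C I"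
    using is_isoE[OF assms(2) e] .
  have me: "m \<cdot> e \<in> Hom C X Y" using Comp_in_Hom[OF e m] .
  have dme: "d \<cdot> (m \<cdot> e) = Zero C X W"
    using Comp_assoc[OF e m d] dm Comp_Zero_left[OF e] Hom_Ob[OF d] by simp
  have ker: "\<exists>!u. u \<in> Hom C T X \<and> (m \<cdot> e) \<cdot> u = t"
    if t: "t \<in> Hom C T Y" "d \<cdot> t = Zero C T W" for T t
  proof -
    have "\<exists>!u. u \<in> Hom C T I \<and> m \<cdot> u = t"
      using kernel_factors[OF _ m d t] assms(1) by (simp add: kernel_cokernel_pair_def)
    then obtain u where u: "u \<in> Hom C T I" "m \<cdot> u = t"
      and uniq: "\<And>v. v \<in> Hom C T I \<Longrightarrow> m \<cdot> v = t \<Longrightarrow> v = u" by blast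
    show ?thesis
    \<comment> \<open>The factorization \<open>u\<close> through \<open>m\<close> is pulled back to
      \<open>X\<close> by the inverse \<open>g\<close> of \<open>e\<close>.\<close>
    proof (rule ex1I[of _ "g \<cdot> u"], intro conjI)
      show gu: "g \<cdot> u \<in> Hom C T X" using Comp_in_Hom[OF u(1) g(1)] .
      have "e \<cdot> (g \<cdot> u) = u"
        using Comp_assoc[OF u(1) g(1) e] g(3) Comp_Ident_left[OF u(1)] by simp
      then show "(m \<cdot> e) \<cdot> (g \<cdot> u) = t" using Comp_assoc[OF gu e m] u(2) by simp
    next
      fix v assume v: "v \<in> Hom C T X \<and> (m \<cdot> e) \<cdot> v = t"
      then have v1: "v \<in> Hom C T X" by simp
      have "e \<cdot> v = u"
        using uniq Comp_in_Hom[OF v1 e] Comp_assoc[OF v1 e m] v by simp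
      then show "v = g \<cdot> u"
        using Comp_assoc[OF v1 e g(1)] g(2) Comp_Ident_left[OF v1] by simp
    qed
  qed
  have coker: "\<exists>!u. u \<in> Hom C W T \<and> u \<cdot> d = t"
    if t: "t \<in> Hom C Y T" "t \<cdot> (m \<cdot> e) = Zero C X T" for T t
  proof -
    have "t \<cdot> m = Zero C I T"
      using Comp_iso_eq_Zero[OF e assms(2) Comp_in_Hom[OF m t(1)]] Comp_assoc[OF e m t(1)] t(2)
      by simp
    then show ?thesis
      using cokernel_factors[OF _ m d t(1)] assms(1) by (simp add: kernel_cokernel_pair_def)
  qed
  show ?thesis
    unfolding kernel_cokernel_pair_def is_kernel_def is_cokernel_def
    using ker coker dme
    by (simp add: Hom_Ar[OF me] Hom_Ar[OF d] Hom_Dom[OF me] Hom_Cod[OF me] Hom_Dom[OF d] Hom_Cod[OF d])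
qed

text \<open>Dual to the previous lemma: \<open>m \<cdot> e\<close> kills the same morphisms as
  \<open>e\<close>, and factorizations through \<open>e\<close> are corrected by the inverse of
  \<open>m\<close>.\<close>

lemma kernel_cokernel_pair_Comp_iso_left:
  assumes "kernel_cokernel_pair C k e" and "is_iso C m" and "Cod C e = Dom C m"
  shows "kernel_cokernel_pair C k (m \<cdot> e)"
proof -
  define K X I Y where "K = Dom C k" and "X = Cod C k" and "I = Dom C m" and "Y = Cod C m"
  have k: "k \<in> Hom C K X" and e: "e \<in> Hom C X I" and ek: "e \<cdot> k = Zero C K I"
    using assms(1,3)
    by (auto simp: kernel_cokernel_pair_def is_kernel_def Hom_def K_def X_def I_def)
  have m: "m \<in> Hom C I Y"
    using assms(2) by (simp add: is_iso_def Hom_def I_def Y_def)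
  obtain g where g: "g \<in> Hom C Y I" "g \<cdot> m = Ident C I" "m \<cdot> g = Ident C Y"
    using is_isoE[OF assms(2) m] .
  have me: "m \<cdot> e \<in> Hom C X Y" using Comp_in_Hom[OF e m] .
  have mek: "(m \<cdot> e) \<cdot> k = Zero C K Y"
    using Comp_assoc[OF k e m] ek Comp_Zero_right[OF m] Hom_Ob[OF k] by simp
  have ker: "\<exists>!u. u \<in> Hom C T K \<and> k \<cdot> u = t"
    if t: "t \<in> Hom C T X" "(m \<cdot> e) \<cdot> t = Zero C T Y" for T t
  proof -
    have "e \<cdot> t = Zero C T I"
      using iso_Comp_eq_Zero[OF m assms(2) Comp_in_Hom[OF t(1) e]] Comp_assoc[OF t(1) e m] t(2)
      by simp
    then show ?thesis
      using kernel_factors[OF _ k e t(1)] assms(1) by (simp add: kernel_cokernel_pair_def)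
  qed
  have coker: "\<exists>!u. u \<in> Hom C Y T \<and> u \<cdot> (m \<cdot> e) = t"
    if t: "t \<in> Hom C X T" "t \<cdot> k = Zero C K T" for T t
  proof -
    have "\<exists>!u. u \<in> Hom C I T \<and> u \<cdot> e = t"
      using cokernel_factors[OF _ k e t] assms(1) by (simp add: kernel_cokernel_pair_def)
    then obtain u where u: "u \<in> Hom C I T" "u \<cdot> e = t"
      and uniq: "\<And>v. v \<in> Hom C I T \<Longrightarrow> v \<cdot> e = t \<Longrightarrow> v = u" by blast
    show ?thesis
    proof (rule ex1I[of _ "u \<cdot> g"], intro conjI)
      show ug: "u \<cdot> g \<in> Hom C Y T" using Comp_in_Hom[OF g(1) u(1)] .
      have "(u \<cdot> g) \<cdot> m = u"
        using Comp_assoc[OF m g(1) u(1)] g(2) Comp_Ident_right[OF u(1)] by simp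
      then show "(u \<cdot> g) \<cdot> (m \<cdot> e) = t" using Comp_assoc[OF e m ug] u(2) by simp
    next
      fix v assume v: "v \<in> Hom C Y T \<and> v \<cdot> (m \<cdot> e) = t"
      then have v1: "v \<in> Hom C Y T" by simp
      have "v \<cdot> m = u"
        using uniq Comp_in_Hom[OF m v1] Comp_assoc[OF e m v1] v by simp
      then show "v = u \<cdot> g"
        using Comp_assoc[OF g(1) m v1] g(3) Comp_Ident_right[OF v1] by simp
    qed
  qed
  show ?thesis
    unfolding kernel_cokernel_pair_def is_kernel_def is_cokernel_def
    using ker coker mek
    by (simp add: Hom_Ar[OF me] Hom_Ar[OF k] Hom_Dom[OF me] Hom_Cod[OF me] Hom_Dom[OF k] Hom_Cod[OF k])
qed

end

section \<open>Admissible morphisms composed with isomorphisms\<close>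

context exact_category
begin

lemma exact_pair_Hom:
  assumes "(i, d) \<in> \<E>"
  shows "i \<in> Hom C (Dom C i) (Cod C i)" and "d \<in> Hom C (Cod C i) (Cod C d)"
  using kernel_cokernel[OF assms]
  by (auto simp: kernel_cokernel_pair_def is_kernel_def Hom_def)

lemma admissible_monic_Comp_iso:
  assumes "admissible_monic \<E> m" and "is_iso C e" and "Cod C e = Dom C m"
  shows "admissible_monic \<E> (m \<cdot> e)"
proof -
  obtain d where md: "(m, d) \<in> \<E>" using assms(1) by (auto simp: admissible_monic_def)
  define X I Y W where "X = Dom C e" and "I = Dom C m" and "Y = Cod C m" and "W = Cod C d"
  have m: "m \<in> Hom C I Y" and d: "d \<in> Hom C Y W"
    using exact_pair_Hom[OF md] by (simp_all add: I_def Y_def W_def)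
  have e: "e \<in> Hom C X I"
    using assms(2,3) by (simp add: is_iso_def Hom_def X_def I_def)
  obtain g where g: "g \<in> Hom C I X" "g \<cdot> e = Ident C X" "e \<cdot> g = Ident C I"
    using is_isoE[OF assms(2) e] .
  have me: "m \<cdot> e \<in> Hom C X Y" using Comp_in_Hom[OF e m] .
  have Y: "Y \<in> Ob C" and W: "W \<in> Ob C" using Hom_Ob[OF d] by auto
  \<comment> \<open>The isomorphism of pairs is \<open>g\<close> followed by two identities. Its
    first component runs from the domain of \<open>m\<close> to that of \<open>m \<cdot> e\<close>,
    hence the inverse \<open>g\<close> and not \<open>e\<close>.\<close>
  have "Ident C Y \<cdot> m = (m \<cdot> e) \<cdot> g"
    using Comp_assoc[OF g(1) e m] g(3) Comp_Ident_right[OF m] Comp_Ident_left[OF m] by simp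
  moreover have "Ident C W \<cdot> d = d \<cdot> Ident C Y"
    using Comp_Ident_right[OF d] Comp_Ident_left[OF d] by simp
  moreover have "is_iso C g" using is_isoI[OF g(1) e g(3,2)] .
  ultimately have "isomorphic_pairs C (m, d) (m \<cdot> e, d)"
    unfolding isomorphic_pairs_def
    using g(1) is_iso_Ident[OF Y] is_iso_Ident[OF W] Ident_in_Hom[OF Y] Ident_in_Hom[OF W]
    by (auto simp: Hom_Dom[OF m] Hom_Cod[OF m] Hom_Dom[OF me] Hom_Cod[OF me] Hom_Cod[OF d])
  then show ?thesis
    using iso_closed[OF md] kernel_cokernel_pair_Comp_iso_right[OF kernel_cokernel[OF md] assms(2,3)]
    by (auto simp: admissible_monic_def)
qed

lemma admissible_epic_iso_Comp:
  assumes "admissible_epic \<E> e" and "is_iso C m" and "Cod C e = Dom C m"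
  shows "admissible_epic \<E> (m \<cdot> e)"
proof -
  obtain k where ke: "(k, e) \<in> \<E>" using assms(1) by (auto simp: admissible_epic_def)
  define K X I Y where "K = Dom C k" and "X = Cod C k" and "I = Dom C m" and "Y = Cod C m"
  have k: "k \<in> Hom C K X" and e: "e \<in> Hom C X I"
    using exact_pair_Hom[OF ke] assms(3) by (simp_all add: K_def X_def I_def)
  have m: "m \<in> Hom C I Y"
    using assms(2) by (simp add: is_iso_def Hom_def I_def Y_def)
  have me: "m \<cdot> e \<in> Hom C X Y" using Comp_in_Hom[OF e m] .
  have K: "K \<in> Ob C" and X: "X \<in> Ob C" using Hom_Ob[OF k] by auto
  \<comment> \<open>The isomorphism of pairs consists of two identities and, at the codomain of the
    epic, \<open>m\<close> itself.\<close>
  have "Ident C X \<cdot> k = k \<cdot> Ident C K"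
    using Comp_Ident_right[OF k] Comp_Ident_left[OF k] by simp
  moreover have "m \<cdot> e = (m \<cdot> e) \<cdot> Ident C X"
    using Comp_Ident_right[OF me] by simp
  ultimately have "isomorphic_pairs C (k, e) (k, m \<cdot> e)"
    unfolding isomorphic_pairs_def
    using m assms(2) is_iso_Ident[OF K] is_iso_Ident[OF X] Ident_in_Hom[OF K] Ident_in_Hom[OF X]
    by (auto simp: Hom_Dom[OF k] Hom_Cod[OF k] Hom_Cod[OF e] Hom_Cod[OF me])
  then show ?thesis
    using iso_closed[OF ke] kernel_cokernel_pair_Comp_iso_left[OF kernel_cokernel[OF ke] assms(2,3)]
    by (auto simp: admissible_epic_def)
qed

end

section \<open>Schur's lemma for exact categories\<close>

theorem proposition1p1:
  fixes C :: "('o, 'm, 'x) preadditive_data_scheme"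
    and \<E> :: "('m \<times> 'm) set"
    and X Y :: 'o
    and f :: 'm
  assumes "exact_category C \<E>"
    and "f \<in> Hom C X Y"
    and "f \<noteq> Zero C X Y"
    and "admissible_morphism C \<E> f"
  shows "(simple_object C \<E> X \<longrightarrow> admissible_monic \<E> f) \<and>
         (simple_object C \<E> Y \<longrightarrow> admissible_epic \<E> f)"
proof -
  interpret exact_category C \<E> by fact
  obtain e m where adm: "admissible_epic \<E> e" "admissible_monic \<E> m"
    and em: "Cod C e = Dom C m" and f: "f = m \<cdot>\<^bsub>C\<^esub> e"
    using assms(4) by (auto simp: admissible_morphism_def)
  obtain k where ke: "(k, e) \<in> \<E>" using adm(1) by (auto simp: admissible_epic_def)
  obtain d where md: "(m, d) \<in> \<E>" using adm(2) by (auto simp: admissible_monic_def)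
  define I where "I = Dom C m"
  \<comment> \<open>The factorization only matches the middle object; comparing endpoints with those
    of \<open>f\<close> identifies the outer ones as \<open>X\<close> and \<open>Y\<close>.\<close>
  have "m \<cdot>\<^bsub>C\<^esub> e \<in> Hom C (Cod C k) (Cod C m)"
    using Comp_in_Hom exact_pair_Hom(2)[OF ke] exact_pair_Hom(1)[OF md] em by simp
  then have XY: "Cod C k = X" "Cod C m = Y"
    using assms(2) f by (auto simp: Hom_def)
  have k: "k \<in> Hom C (Dom C k) X" and e: "e \<in> Hom C X I" and m: "m \<in> Hom C I Y"
    using exact_pair_Hom[OF ke] exact_pair_Hom[OF md] em XY by (simp_all add: I_def)
  have X: "X \<in> Ob C" and Y: "Y \<in> Ob C" using Hom_Ob[OF assms(2)] by auto
  \<comment> \<open>Either factor being zero would make \<open>f\<close> zero. \<open>e0\<close>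
    will rule out an invertible \<open>k\<close>, and \<open>m0\<close> a zero object
    \<open>I\<close>.\<close>
  have e0: "e \<noteq> Zero C X I"
    using assms(3) f Comp_Zero_right[OF m X] by auto
  have m0: "m \<noteq> Zero C I Y"
    using assms(3) f Comp_Zero_left[OF e Y] by auto
  have ek: "e \<cdot>\<^bsub>C\<^esub> k = Zero C (Dom C k) I" and coker: "is_cokernel C e k"
    using kernel_cokernel[OF ke] Hom_Cod[OF e]
    by (auto simp: kernel_cokernel_pair_def is_cokernel_def)
  have "admissible_monic \<E> f" if "simple_object C \<E> X"
  proof -
    have "subobject C \<E> X (Dom C k) k"
      using k ke by (auto simp: subobject_def admissible_monic_def)
    moreover have "\<not> is_iso C k" using Comp_iso_eq_Zero[OF k _ e ek] e0 by blast
    ultimately have "is_zero_object C (Dom C k)"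
      using that by (auto simp: simple_object_def)
    then show ?thesis
      using admissible_monic_Comp_iso[OF adm(2) cokernel_of_zero_object_iso[OF coker] em] f by simp
  qed
  moreover have "admissible_epic \<E> f" if "simple_object C \<E> Y"
  proof -
    have "subobject C \<E> Y I m" using m adm(2) by (simp add: subobject_def)
    moreover have "\<not> is_zero_object C I" using from_zero_object_eq_Zero[OF _ m] m0 by blast
    ultimately have "is_iso C m" using that by (auto simp: simple_object_def)
    then show ?thesis using admissible_epic_iso_Comp[OF adm(1) _ em] f by simp
  qed
  ultimately show ?thesis by blast
qed

end
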